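(* For every integer $k \geq 1$, there exists a perfect graph $H_k$ such that $c_{\mathbf{GSP}}(H_k) \geq \frac{k}{2}$.
   Context: Graphs are finite, simple and have a nonempty vertex set; $\chi$ denotes the chromatic number and $\omega$ the clique number. For a class of graphs $\mathcal{P}$, a covering of a graph $G$ by graphs of class $\mathcal{P}$ is an expression $E(G) = E(G_1) \cup \dots \cup E(G_m)$ with $m \geq 1$, where each $G_i$ is a graph on the vertex set $V(G)$ and $G_i \in \mathcal{P}$. The cover number $c_{\mathcal{P}}(G)$ is the smallest such $m$ ($\infty$ if no covering exists). A graph is perfect if it and all of its induced subgraphs $H$ satisfy $\chi(H) = \omega(H)$. A graph is unipolar if its vertex set is a disjoint union $A \cup B$ (either part possibly empty) such that $A$ induces a clique and $B$ induces a disjoint union of cliques. A graph is co-unipolar if its complement is unipolar, and generalized split (GSP) if it is unipolar or co-unipolar. $c_{\mathbf{GSP}}$ denotes the cover number by GSP graphs. *)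

theory Defs
  imports "HOL-Library.Disjoint_Sets" "HOL-Library.Extended_Real"
begin

type_synonym 'a ugraph = "'a set \<times> 'a set set"

abbreviation verts :: "'a ugraph \<Rightarrow> 'a set" where
  "verts G \<equiv> fst G"

abbreviation edges :: "'a ugraph \<Rightarrow> 'a set set" where
  "edges G \<equiv> snd G"

definition all_pairs :: "'a set \<Rightarrow> 'a set set" where
  "all_pairs V = {e. e \<subseteq> V \<and> card e = 2}"

definition is_graph :: "'a ugraph \<Rightarrow> bool" where
  "is_graph G \<longleftrightarrow> finite (verts G) \<and> verts G \<noteq> {} \<and> edges G \<subseteq> all_pairs (verts G)"

definition induced :: "'a ugraph \<Rightarrow> 'a set \<Rightarrow> 'a ugraph" where
  "induced G W = (W, {e \<in> edges G. e \<subseteq> W})"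

definition complement :: "'a ugraph \<Rightarrow> 'a ugraph" where
  "complement G = (verts G, all_pairs (verts G) - edges G)"

definition clique :: "'a ugraph \<Rightarrow> 'a set \<Rightarrow> bool" where
  "clique G K \<longleftrightarrow> K \<subseteq> verts G \<and> all_pairs K \<subseteq> edges G"

definition clique_number :: "'a ugraph \<Rightarrow> nat" where
  "clique_number G = Max {card K |K. clique G K}"

definition proper_coloring :: "'a ugraph \<Rightarrow> nat \<Rightarrow> ('a \<Rightarrow> nat) \<Rightarrow> bool" where
  "proper_coloring G n c \<longleftrightarrow>
     c ` verts G \<subseteq> {..<n} \<and> (\<forall>u v. {u, v} \<in> edges G \<longrightarrow> c u \<noteq> c v)"

definition chromatic_number :: "'a ugraph \<Rightarrow> nat" where
  "chromatic_number G = (LEAST n. \<exists>c. proper_coloring G n c)"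

text \<open>Taking \<open>W = verts G\<close> covers the graph itself; \<open>W\<close> is nonempty because
  graphs have a nonempty vertex set.\<close>

definition perfect :: "'a ugraph \<Rightarrow> bool" where
  "perfect G \<longleftrightarrow> is_graph G \<and>
     (\<forall>W. W \<noteq> {} \<and> W \<subseteq> verts G \<longrightarrow>
        chromatic_number (induced G W) = clique_number (induced G W))"

text \<open>The blocks of \<open>P\<close> are the cliques; edges inside \<open>B\<close> are exactly the pairs
  contained in one block.  The empty set qualifies, with \<open>P = {}\<close>.\<close>

definition induces_disjoint_cliques :: "'a ugraph \<Rightarrow> 'a set \<Rightarrow> bool" where
  "induces_disjoint_cliques G B \<longleftrightarrow>
     (\<exists>P. partition_on B P \<and> edges (induced G B) = (\<Union>C\<in>P. all_pairs C))"

definition unipolar :: "'a ugraph \<Rightarrow> bool" where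
  "unipolar G \<longleftrightarrow> is_graph G \<and>
     (\<exists>A B. A \<union> B = verts G \<and> A \<inter> B = {} \<and> clique G A \<and> induces_disjoint_cliques G B)"

definition co_unipolar :: "'a ugraph \<Rightarrow> bool" where
  "co_unipolar G \<longleftrightarrow> is_graph G \<and> unipolar (complement G)"

definition GSP :: "'a ugraph set" where
  "GSP = {G. unipolar G \<or> co_unipolar G}"

definition is_covering ::
  "'a ugraph set \<Rightarrow> 'a ugraph \<Rightarrow> nat \<Rightarrow> (nat \<Rightarrow> 'a ugraph) \<Rightarrow> bool" where
  "is_covering \<P> G m Gs \<longleftrightarrow> m \<ge> 1 \<and>
     (\<forall>i<m. is_graph (Gs i) \<and> verts (Gs i) = verts G \<and> Gs i \<in> \<P>) \<and>
     edges G = (\<Union>i<m. edges (Gs i))"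

text \<open>In \<^typ>\<open>enat\<close> the infimum of the empty set is \<open>\<infinity>\<close>.\<close>

definition cover_number :: "'a ugraph set \<Rightarrow> 'a ugraph \<Rightarrow> enat" where
  "cover_number \<P> G = Inf {enat m |m. \<exists>Gs. is_covering \<P> G m Gs}"

end

theory Submission
  imports Defs "HOL-Library.Nat_Bijection"
begin

text \<open>
  The graph \<open>H\<close> is a disjoint union of \<open>k\<close> copies of one complete multipartite graph with many
  large parts.  It is perfect: in an induced subgraph, colour each vertex by the rank of its part
  among the parts that are still present in its component; the component with the most parts
  contains a clique with one vertex from each of them (\<open>perfect_multipartite_union\<close>).

  The components serve to weaken the covering graphs.  A spanning GSP subgraph can have a rich
  structure on at most one component.  In a unipolar graph the central clique lies within one
  component, and the graph is a disjoint union of cliques elsewhere.  In a co-unipolar graph the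
  complete multipartite side is either independent, so that the whole graph is bipartite, or
  connected, so that it lies within one component and there are no edges elsewhere
  (\<open>GSP_subgraph_off_one_component\<close>).

  So if fewer than \<open>k\<close> graphs cover \<open>H\<close>, then on some component each of them is bipartite or a
  disjoint union of cliques.  The sides of the bipartitions give every vertex a profile, one of at
  most \<open>2 ^ k\<close>.  As the parts are large, each contains many vertices with a common profile, and as
  there are more than \<open>2 ^ k\<close> parts, two of them share this profile.  Fix a vertex \<open>x\<close> in one of
  these parts.  Two of its edges into the other part, to vertices \<open>y \<noteq> z\<close> with the profile of
  \<open>x\<close>, lie in the same covering graph.  That graph is not bipartite there, so it is a disjoint union
  of cliques and contains the edge \<open>{y, z}\<close>, although \<open>y\<close> and \<open>z\<close> lie in the same part.
\<close>

section \<open>Disjoint unions of complete multipartite graphs\<close>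

text \<open>The structure sits in two labelling functions rather than in a product type of vertices, so
  that passing to an induced subgraph only shrinks \<open>V\<close>.  The parts are numbered because the
  colouring ranks them.\<close>

definition multipartite_union :: "'a set \<Rightarrow> ('a \<Rightarrow> nat) \<Rightarrow> ('a \<Rightarrow> nat) \<Rightarrow> 'a ugraph" where
  "multipartite_union V component part =
     (V, {{u, v} |u v. u \<in> V \<and> v \<in> V \<and> component u = component v \<and> part u \<noteq> part v})"

lemma verts_multipartite_union [simp]: "verts (multipartite_union V component part) = V"
  by (simp add: multipartite_union_def)

lemma edge_multipartite_union_iff:
  "{u, v} \<in> edges (multipartite_union V component part) \<longleftrightarrow>
     u \<in> V \<and> v \<in> V \<and> component u = component v \<and> part u \<noteq> part v"
  by (auto simp: multipartite_union_def doubleton_eq_iff)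

lemma all_pairs_iff: "e \<in> all_pairs V \<longleftrightarrow> (\<exists>u v. e = {u, v} \<and> u \<noteq> v \<and> u \<in> V \<and> v \<in> V)"
  by (auto simp: all_pairs_def card_2_iff)

lemma pair_in_all_pairs_iff: "{u, v} \<in> all_pairs V \<longleftrightarrow> u \<noteq> v \<and> u \<in> V \<and> v \<in> V"
  by (auto simp: all_pairs_iff doubleton_eq_iff)

lemma is_graph_multipartite_union:
  "finite V \<Longrightarrow> V \<noteq> {} \<Longrightarrow> is_graph (multipartite_union V component part)"
  unfolding is_graph_def by (auto simp: multipartite_union_def pair_in_all_pairs_iff)

lemma induced_multipartite_union:
  "W \<subseteq> V \<Longrightarrow> induced (multipartite_union V component part) W = multipartite_union W component part"
  by (auto simp: induced_def multipartite_union_def)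

lemma card_clique_le_colors:
  assumes "clique G K" "proper_coloring G n c"
  shows "card K \<le> n"
proof -
  have "inj_on c K"
  proof (rule inj_onI, rule ccontr)
    fix u v assume "u \<in> K" "v \<in> K" "c u = c v" "u \<noteq> v"
    then show False
      using assms by (auto simp: clique_def proper_coloring_def pair_in_all_pairs_iff subset_iff)
  qed
  moreover have "c ` K \<subseteq> {..<n}"
    using assms by (auto simp: clique_def proper_coloring_def)
  ultimately show ?thesis
    using card_inj_on_le[of c K "{..<n}"] by simp
qed

lemma chromatic_eq_clique_numberI:
  assumes "clique G K" "proper_coloring G (card K) c"
  shows "chromatic_number G = clique_number G"
proof -
  have "chromatic_number G = card K"
    unfolding chromatic_number_def
    using assms card_clique_le_colors[OF assms(1)] by (intro Least_equality) blast+
  moreover have "clique_number G = card K"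
    unfolding clique_number_def
  proof (rule Max_eqI)
    show "finite {card K |K. clique G K}"
      using card_clique_le_colors[OF _ assms(2)]
      by (auto intro: finite_subset[of _ "{..card K}"])
  qed (use assms(1) card_clique_le_colors[OF _ assms(2)] in auto)
  ultimately show ?thesis by simp
qed

lemma chromatic_eq_clique_number_multipartite_union:
  assumes "finite W" "W \<noteq> {}"
  shows "chromatic_number (multipartite_union W component part)
       = clique_number (multipartite_union W component part)"
proof -
  define parts where "parts i = part ` {w \<in> W. component w = i}" for i
  have fin: "finite (parts i)" for i
    using assms by (simp add: parts_def)
  \<comment> \<open>A component with the most parts present in \<open>W\<close> determines both numbers.\<close>
  obtain w0 where "w0 \<in> W" and max: "card (parts (component w)) \<le> card (parts (component w0))"
    if "w \<in> W" for w
  proof -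
    have "Max ((\<lambda>w. card (parts (component w))) ` W) \<in> (\<lambda>w. card (parts (component w))) ` W"
      using assms by (intro Max_in) auto
    then obtain w0 where "w0 \<in> W" "Max ((\<lambda>w. card (parts (component w))) ` W) = card (parts (component w0))"
      by auto
    then show thesis
      using assms that by (metis Max_ge finite_imageI imageI)
  qed
  obtain K where K: "K \<subseteq> {w \<in> W. component w = component w0}" "inj_on part K" "parts (component w0) = part ` K"
    using subset_image_inj[of "parts (component w0)" part "{w \<in> W. component w = component w0}"]
    by (auto simp: parts_def)
  have card_K: "card K = card (parts (component w0))"
    using K by (simp add: card_image)
  show ?thesis
  proof (rule chromatic_eq_clique_numberI)
    show "clique (multipartite_union W component part) K"
      using K(1,2)
      by (auto simp: clique_def all_pairs_iff edge_multipartite_union_iff inj_on_eq_iff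
          subset_iff[of K])
    define c where "c v = card {q \<in> parts (component v). q < part v}" for v
    have less: "c u < c v" if "u \<in> W" "component u = component v" "part u < part v" for u v
    proof -
      have "{q \<in> parts (component u). q < part u} \<subset> {q \<in> parts (component v). q < part v}"
        using that by (auto simp: parts_def)
      then show ?thesis
        unfolding c_def using fin by (intro psubset_card_mono) auto
    qed
    have "c v < card K" if "v \<in> W" for v
    proof -
      have "{q \<in> parts (component v). q < part v} \<subset> parts (component v)"
        using that by (auto simp: parts_def)
      then have "c v < card (parts (component v))"
        unfolding c_def using fin by (intro psubset_card_mono)
      then show ?thesis
        using max[OF that] card_K by simp
    qed
    moreover have "c u \<noteq> c v" if "{u, v} \<in> edges (multipartite_union W component part)" for u v
      using that less[of u v] less[of v u]
      by (auto simp: edge_multipartite_union_iff neq_iff)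
    ultimately show "proper_coloring (multipartite_union W component part) (card K) c"
      by (auto simp: proper_coloring_def)
  qed
qed

lemma perfect_multipartite_union:
  assumes "finite V" "V \<noteq> {}"
  shows "perfect (multipartite_union V component part)"
  using assms finite_subset
  by (auto simp: perfect_def is_graph_multipartite_union induced_multipartite_union
      intro!: chromatic_eq_clique_number_multipartite_union)

section \<open>Generalized split subgraphs of a disconnected graph\<close>

lemma induces_disjoint_cliques_trans:
  assumes "induces_disjoint_cliques G B"
    and "x \<in> B" "y \<in> B" "z \<in> B" "{x, y} \<in> edges G" "{x, z} \<in> edges G" "y \<noteq> z"
  shows "{y, z} \<in> edges G"
proof -
  obtain P where P: "partition_on B P" "{e \<in> edges G. e \<subseteq> B} = (\<Union>C\<in>P. all_pairs C)"
    using assms(1) by (auto simp: induces_disjoint_cliques_def induced_def)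
  have "{x, y} \<in> (\<Union>C\<in>P. all_pairs C)" "{x, z} \<in> (\<Union>C\<in>P. all_pairs C)"
    unfolding P(2)[symmetric] using assms by auto
  then obtain C D where CD: "C \<in> P" "D \<in> P" "x \<in> C" "y \<in> C" "x \<in> D" "z \<in> D"
    by (auto simp: pair_in_all_pairs_iff)
  then have "C = D"
    using partition_onD2[OF P(1)] by (auto simp: disjoint_def)
  with CD assms(7) have "{y, z} \<in> (\<Union>C\<in>P. all_pairs C)"
    by (auto simp: pair_in_all_pairs_iff)
  then show ?thesis
    unfolding P(2)[symmetric] by simp
qed

text \<open>The conclusion merges the two ways in which \<open>G\<close> can look away from component \<open>c\<close>.
  If \<open>G\<close> is bipartite with side \<open>S\<close>, then no edge has both ends on the same side, and the
  implication is vacuous; if \<open>G\<close> is a disjoint union of cliques, then the implication holds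
  because adjacency is transitive.\<close>

lemma GSP_subgraph_off_one_component:
  fixes component :: "'a \<Rightarrow> 'b"
  assumes G: "G \<in> GSP"
    and component: "\<And>u v. {u, v} \<in> edges G \<Longrightarrow> component u = component v"
  shows "\<exists>c S. \<forall>x y z. component x \<noteq> c \<and> {x, y} \<in> edges G \<and> {x, z} \<in> edges G \<and> y \<noteq> z \<and>
           (x \<in> S \<longleftrightarrow> y \<in> S) \<longrightarrow> {y, z} \<in> edges G"
proof -
  have graph: "is_graph G"
    using G by (auto simp: GSP_def unipolar_def co_unipolar_def)
  then have ends: "u \<in> verts G \<and> v \<in> verts G \<and> u \<noteq> v" if "{u, v} \<in> edges G" for u v
    using that pair_in_all_pairs_iff[of u v "verts G"] unfolding is_graph_def by blast
  consider (uni) "unipolar G" | (co) "unipolar (complement G)"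
    using G by (auto simp: GSP_def co_unipolar_def)
  then show ?thesis
  proof cases
    case uni
    then obtain A B where AB: "A \<union> B = verts G" "clique G A" "induces_disjoint_cliques G B"
      by (auto simp: unipolar_def)
    obtain c where c: "component a = c" if "a \<in> A" for a
    proof (cases "A = {}")
      case False
      then obtain a0 where "a0 \<in> A" by auto
      have "component a = component a0" if "a \<in> A" for a
      proof (cases "a = a0")
        case False
        then have "{a, a0} \<in> edges G"
          using AB(2) that \<open>a0 \<in> A\<close> by (auto simp: clique_def pair_in_all_pairs_iff subset_iff)
        then show ?thesis by (rule component)
      qed simp
      with that show thesis by blast
    qed auto
    have "{y, z} \<in> edges G"
      if "component x \<noteq> c" "{x, y} \<in> edges G" "{x, z} \<in> edges G" "y \<noteq> z" for x y z
    proof (rule induces_disjoint_cliques_trans[OF AB(3)])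
      show "x \<in> B" "y \<in> B" "z \<in> B"
        using that c component ends AB(1) by (metis Un_iff)+
    qed (use that in auto)
    then show ?thesis by blast
  next
    case co
    then obtain A B where AB: "A \<union> B = verts G" "clique (complement G) A"
        "induces_disjoint_cliques (complement G) B"
      by (auto simp: unipolar_def complement_def)
    have indep: "{u, v} \<notin> edges G" if "u \<in> A" "v \<in> A" for u v
      using AB(2) that ends
      by (fastforce simp: clique_def complement_def subset_iff pair_in_all_pairs_iff)
    show ?thesis
    proof (cases "\<exists>u\<in>B. \<exists>v\<in>B. {u, v} \<in> edges G")
      case False
      then have "x \<in> A \<longleftrightarrow> y \<notin> A" if "{x, y} \<in> edges G" for x y
        using that indep ends AB(1) by (metis Un_iff)
      then show ?thesis by blast
    next
      case True
      then obtain u v where uv: "u \<in> B" "v \<in> B" "{u, v} \<in> edges G" by auto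
      \<comment> \<open>Non-adjacency is transitive on \<open>B\<close>, so each vertex of \<open>B\<close> is adjacent to one end of
         the edge \<open>{u, v}\<close>, unless it is itself such an end.\<close>
      have B: "component w = component u" if "w \<in> B" for w
      proof (rule ccontr)
        assume neq: "component w \<noteq> component u"
        have "{w, u} \<notin> edges G" "{w, v} \<notin> edges G" "w \<noteq> u" "w \<noteq> v"
          using neq component uv(3) by metis+
        then have "{w, u} \<in> edges (complement G)" "{w, v} \<in> edges (complement G)"
          using that uv(1,2) AB(1) by (auto simp: complement_def pair_in_all_pairs_iff)
        then have "{u, v} \<in> edges (complement G)"
          using induces_disjoint_cliques_trans[OF AB(3)] that uv ends by blast
        with uv(3) show False
          by (simp add: complement_def)
      qed
      have "{x, y} \<notin> edges G" if "component x \<noteq> component u" for x y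
        using that B component ends indep AB(1) by (metis Un_iff)
      then show ?thesis by blast
    qed
  qed
qed

section \<open>Few generalized split graphs do not cover\<close>

lemma pigeonhole_large_fibre:
  assumes "finite A" "finite T" "f ` A \<subseteq> T" "k * card T < card A"
  shows "\<exists>t\<in>T. k < card {a \<in> A. f a = t}"
proof (rule ccontr)
  assume "\<not> ?thesis"
  then have "(\<Sum>t\<in>T. card {a \<in> A. f a = t}) \<le> (\<Sum>t\<in>T. k)"
    by (intro sum_mono) (auto simp: not_less)
  moreover have "(\<Sum>t\<in>T. card {a \<in> A. f a = t}) = card A"
    using sum.group[OF assms(1-3), of "\<lambda>_. 1::nat"] by simp
  ultimately show False
    using assms(4) by (simp add: mult.commute)
qed

text \<open>The bound on the part sizes is what the profiles require: there are at most \<open>2 ^ k\<close> of them,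
  so some profile occurs more than \<open>k\<close> times in a given part.  Having \<open>2 ^ k + 1\<close> parts then
  forces two of them to agree on such a profile.\<close>

lemma covering_multipartite_union_size:
  fixes V :: "'a set"
  assumes "finite V"
    and large: "\<And>j p. j < k \<Longrightarrow> p \<le> 2 ^ k \<Longrightarrow>
        k * 2 ^ k < card {v \<in> V. component v = j \<and> part v = p}"
    and cov: "is_covering GSP (multipartite_union V component part) m Gs"
  shows "k \<le> m"
proof (rule ccontr)
  assume "\<not> k \<le> m"
  then have "m < k" by simp
  let ?H = "multipartite_union V component part"
  have edges_H: "edges ?H = (\<Union>i<m. edges (Gs i))"
    using cov by (simp add: is_covering_def)
  have GSP: "Gs i \<in> GSP" if "i < m" for i
    using cov that by (simp add: is_covering_def)
  have edge: "u \<in> V \<and> v \<in> V \<and> component u = component v \<and> part u \<noteq> part v"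
    if "i < m" "{u, v} \<in> edges (Gs i)" for i u v
    using that edges_H by (subst edge_multipartite_union_iff[symmetric]) auto
  have "\<exists>c S. \<forall>x y z. component x \<noteq> c \<and> {x, y} \<in> edges (Gs i) \<and> {x, z} \<in> edges (Gs i) \<and> y \<noteq> z \<and>
           (x \<in> S \<longleftrightarrow> y \<in> S) \<longrightarrow> {y, z} \<in> edges (Gs i)" if "i < m" for i
    using GSP_subgraph_off_one_component[OF GSP[OF that], of component] edge[OF that] by blast
  then obtain c S where cS: "\<And>i x y z. i < m \<Longrightarrow> component x \<noteq> c i \<Longrightarrow> {x, y} \<in> edges (Gs i) \<Longrightarrow>
      {x, z} \<in> edges (Gs i) \<Longrightarrow> y \<noteq> z \<Longrightarrow> (x \<in> S i \<longleftrightarrow> y \<in> S i) \<Longrightarrow> {y, z} \<in> edges (Gs i)"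
    by metis
  have "card (c ` {..<m}) < card {..<k}"
    using card_image_le[of "{..<m}" c] \<open>m < k\<close> by simp
  \<comment> \<open>On component \<open>j\<close> every covering graph is bipartite or a disjoint union of cliques.\<close>
  then obtain j where j: "j < k" "j \<notin> c ` {..<m}"
    by (metis card_mono finite_imageI finite_lessThan leD lessThan_iff subsetI)
  define profile where "profile v = {i. i < m \<and> v \<in> S i}" for v
  define fibre where "fibre p Q = {v \<in> {v \<in> V. component v = j \<and> part v = p}. profile v = Q}" for p Q
  have "\<exists>Q\<in>Pow {..<k}. k < card (fibre p Q)" if "p \<le> 2 ^ k" for p
    unfolding fibre_def
  proof (rule pigeonhole_large_fibre)
    show "k * card (Pow {..<k}) < card {v \<in> V. component v = j \<and> part v = p}"
      using large[OF j(1) that] by (simp add: card_Pow)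
  qed (use \<open>m < k\<close> \<open>finite V\<close> in \<open>auto simp: profile_def\<close>)
  then obtain Q where Q: "Q p \<subseteq> {..<k}" "k < card (fibre p (Q p))" if "p \<le> 2 ^ k" for p
    by (metis PowD)
  have "\<not> inj_on Q {..2 ^ k}"
  proof (rule pigeonhole)
    have "card (Q ` {..2 ^ k}) \<le> card (Pow {..<k})"
      using Q(1) by (intro card_mono) auto
    then show "card (Q ` {..2 ^ k}) < card {..(2::nat) ^ k}"
      by (simp add: card_Pow)
  qed
  then obtain p q where pq: "p \<le> 2 ^ k" "q \<le> 2 ^ k" "p \<noteq> q" "Q p = Q q"
    by (auto simp: inj_on_def)
  obtain x where x: "x \<in> fibre p (Q p)"
    using Q(2)[OF pq(1)] by (metis card.empty ex_in_conv not_less_zero)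
  define Y where "Y = fibre q (Q q)"
  have "\<exists>i<m. {x, y} \<in> edges (Gs i)" if "y \<in> Y" for y
  proof -
    have "{x, y} \<in> edges ?H"
      using x that pq(3) by (simp add: edge_multipartite_union_iff fibre_def Y_def)
    then show ?thesis
      using cov by (auto simp: is_covering_def)
  qed
  then obtain g where g: "\<And>y. y \<in> Y \<Longrightarrow> g y < m \<and> {x, y} \<in> edges (Gs (g y))"
    by metis
  have "\<not> inj_on g Y"
  proof (rule pigeonhole)
    have "card (g ` Y) \<le> card {..<m}"
      using g by (intro card_mono) auto
    also have "\<dots> < card Y"
      using Q(2)[OF pq(2)] \<open>m < k\<close> by (simp add: Y_def)
    finally show "card (g ` Y) < card Y" .
  qed
  then obtain y z where yz: "y \<in> Y" "z \<in> Y" "y \<noteq> z" "g y = g z"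
    by (auto simp: inj_on_def)
  have "{y, z} \<in> edges (Gs (g y))"
  proof (rule cS)
    show "component x \<noteq> c (g y)"
      using x j(2) g[OF yz(1)] by (auto simp: fibre_def)
    have "profile x = profile y"
      using x yz(1) pq(4) by (simp add: fibre_def Y_def)
    then show "x \<in> S (g y) \<longleftrightarrow> y \<in> S (g y)"
      using g[OF yz(1)] by (auto simp: profile_def)
    show "{x, z} \<in> edges (Gs (g y))"
      using g[OF yz(2)] yz(4) by simp
  qed (use g[OF yz(1)] yz(3) in auto)
  then have "part y \<noteq> part z"
    using edge g[OF yz(1)] by blast
  then show False
    using yz(1,2) by (simp add: Y_def fibre_def)
qed

theorem theorem8:
  fixes k :: nat
  assumes "k \<ge> 1"
  shows "\<exists>H :: nat ugraph.
    perfect H \<and> ereal_of_enat (cover_number GSP H) \<ge> ereal (real k / 2)"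
proof -
  \<comment> \<open>A vertex encodes a triple of component, part and index within the part.\<close>
  define vertex :: "nat \<Rightarrow> nat \<Rightarrow> nat \<Rightarrow> nat"
    where "vertex j p x = prod_encode (j, prod_encode (p, x))" for j p x
  define component where "component v = fst (prod_decode v)" for v
  define part where "part v = fst (prod_decode (snd (prod_decode v)))" for v
  define V where "V = (\<lambda>(j, p, x). vertex j p x) ` ({..<k} \<times> {..2 ^ k} \<times> {..k * 2 ^ k})"
  define H where "H = multipartite_union V component part"
  have [simp]: "component (vertex j p x) = j" "part (vertex j p x) = p" for j p x
    unfolding component_def part_def vertex_def by simp_all
  have "finite V" "V \<noteq> {}"
    using assms by (auto simp: V_def lessThan_empty_iff)
  then have "perfect H"
    unfolding H_def by (rule perfect_multipartite_union)
  have large: "k * 2 ^ k < card {v \<in> V. component v = j \<and> part v = p}" if "j < k" "p \<le> 2 ^ k" for j p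
  proof -
    have "inj (vertex j p)"
      by (auto simp: inj_def vertex_def)
    then have "card (vertex j p ` {..k * 2 ^ k}) = Suc (k * 2 ^ k)"
      by (subst card_image) (auto intro: inj_on_subset)
    moreover have "vertex j p ` {..k * 2 ^ k} \<subseteq> {v \<in> V. component v = j \<and> part v = p}"
      using that by (force simp: V_def)
    then have "card (vertex j p ` {..k * 2 ^ k}) \<le> card {v \<in> V. component v = j \<and> part v = p}"
      using \<open>finite V\<close> by (intro card_mono) auto
    ultimately show ?thesis by simp
  qed
  have "enat k \<le> cover_number GSP H"
    unfolding cover_number_def H_def
    using covering_multipartite_union_size[OF \<open>finite V\<close> large] by (auto intro!: Inf_greatest)
  then have "ereal (real k) \<le> ereal_of_enat (cover_number GSP H)"
    by (metis ereal_of_enat_le_iff ereal_of_enat_simps(1))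
  then have "ereal (real k / 2) \<le> ereal_of_enat (cover_number GSP H)"
    by (rule order_trans[rotated]) simp
  with \<open>perfect H\<close> show ?thesis by blast
qed

end
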